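(* Let $p$ be an odd prime and let $k \ge 2$ be an integer. If $g$ is a primitive root of $p^{k}$, then $g + tp^{k}$ is a primitive root of $p^{k+1}$ for every integer $t$ with $0 \le t \le p-1$. Furthermore, all the primitive roots of $p^{k+1}$ can be constructed this way: for every primitive root $r$ of $p^{k+1}$ with $1 \le r \le p^{k+1}$ there exist a primitive root $g$ of $p^{k}$ with $1 \le g \le p^{k}$ and an integer $t$ with $0 \le t \le p-1$ such that $r = g + tp^{k}$.
   Context: For a positive integer $n$ and an integer $a$ relatively prime to $n$, the order of $a$ mod $n$, written $\mathrm{ord}_{n}(a)$, is the smallest positive integer $m$ such that $a^{m} \equiv 1 \pmod{n}$. The integer $a$ is called a primitive root of $n$ if $\gcd(a,n)=1$ and $\mathrm{ord}_{n}(a) = \varphi(n)$, where $\varphi$ is the Euler totient function. Being a primitive root of $n$ depends only on the congruence class of $a$ mod $n$; when listing the primitive roots of $n$, one uses representatives from the standard reduced residue system $\{1 \le a \le n : \gcd(a,n) = 1\}$. *)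

theory Defs
  imports "HOL-Number_Theory.Number_Theory"
begin

text \<open>
  The library's \<^const>\<open>ord\<close> and \<^const>\<open>residue_primroot\<close> only accept natural-number residues.
  Here the residue is an arbitrary (possibly negative) integer; the lemmas below show that the
  notions agree on natural numbers.
\<close>

definition int_ord :: "nat \<Rightarrow> int \<Rightarrow> nat" where
  "int_ord n a = (LEAST m. 0 < m \<and> [a ^ m = 1] (mod int n))"

definition primitive_root :: "nat \<Rightarrow> int \<Rightarrow> bool" where
  "primitive_root n a \<longleftrightarrow> n > 0 \<and> coprime a (int n) \<and> int_ord n a = totient n"

lemma int_ord_of_nat:
  assumes "coprime n a"
  shows "int_ord n (int a) = ord n a"
proof -
  have cong: "[int a ^ m = 1] (mod int n) \<longleftrightarrow> [a ^ m = 1] (mod n)" for m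
    using cong_int_iff[of "a ^ m" 1 n] by simp
  show ?thesis
    unfolding int_ord_def cong
  proof (rule Least_equality)
    show "0 < ord n a \<and> [a ^ ord n a = 1] (mod n)"
      using assms ord_works[of a n] by (simp add: ord_eq_0 coprime_commute)
  next
    fix m assume "0 < m \<and> [a ^ m = 1] (mod n)"
    thus "ord n a \<le> m"
      using ord_divides[of a m n] dvd_imp_le by blast
  qed
qed

lemma primitive_root_of_nat: "primitive_root n (int g) \<longleftrightarrow> residue_primroot n g"
  by (auto simp: primitive_root_def residue_primroot_def int_ord_of_nat coprime_commute)

end

theory Submission
  imports Defs
begin

text \<open>
  Raising to the \<open>p\<close>-th power turns a congruence \<open>x \<equiv> 1\<close> modulo \<open>p ^ j\<close> into one modulo
  \<open>p ^ (j + 1)\<close>, while \<open>totient (p ^ (j + 1)) = p * totient (p ^ j)\<close>; hence a primitive root of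
  \<open>p ^ (j + 1)\<close> is one of \<open>p ^ j\<close>. So a primitive root \<open>g\<close> of \<open>p ^ k\<close> with \<open>k \<ge> 2\<close> is one of
  \<open>p\<close> and of \<open>p\<^sup>2\<close>, the latter excludes \<open>g ^ (p - 1) \<equiv> 1\<close> modulo \<open>p\<^sup>2\<close>, and therefore \<open>g\<close> is a
  primitive root of every power of \<open>p\<close>.
\<close>

text \<open>Factor \<open>x ^ q - 1\<close> as \<open>x - 1\<close> times the geometric sum of the
  \<open>x ^ i\<close> with \<open>i < q\<close>. The first factor is divisible by \<open>m\<close>;
  as \<open>x\<close> is 1 modulo \<open>q\<close> too, the sum is congruent to \<open>q\<close>,
  hence to 0, modulo \<open>q\<close>.\<close>

lemma cong_1_power_mult:
  fixes x m q :: nat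
  assumes "[x = 1] (mod m)" and "q dvd m"
  shows "[x ^ q = 1] (mod q * m)"
proof -
  have x: "[int x = 1] (mod int m)"
    using assms(1) cong_int_iff[of x 1 m] by simp
  hence "[int x = 1] (mod int q)"
    by (rule cong_dvd_modulus) (use assms(2) in simp)
  hence "[(\<Sum>i<q. int x ^ i) = (\<Sum>i<q. 1 ^ i)] (mod int q)"
    by (intro cong_sum cong_pow)
  hence "int q dvd (\<Sum>i<q. int x ^ i)"
    by (simp add: cong_dvd_iff)
  moreover have "int m dvd int x - 1"
    using x by (simp add: cong_iff_dvd_diff)
  ultimately have "int m * int q dvd (int x - 1) * (\<Sum>i<q. int x ^ i)"
    by (intro mult_dvd_mono)
  also have "\<dots> = int x ^ q - 1"
    by (simp add: power_diff_1_eq)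
  finally have "[int (x ^ q) = int 1] (mod int (q * m))"
    by (simp add: cong_iff_dvd_diff mult.commute)
  thus ?thesis
    by (simp only: cong_int_iff)
qed

lemma residue_primroot_prime_power_SucD:
  assumes "prime p" "j > 0" and g: "residue_primroot (p ^ Suc j) g"
  shows "residue_primroot (p ^ j) g"
proof -
  have p: "p > 0"
    using assms(1) by (rule prime_gt_0_nat)
  have g_coprime: "coprime (p ^ j) g"
    using g by (simp add: residue_primroot_def)
  define d where "d = ord (p ^ j) g"
  have "[g ^ d = 1] (mod p ^ j)"
    by (simp add: d_def ord_divides')
  hence "[(g ^ d) ^ p = 1] (mod p * p ^ j)"
    using \<open>j > 0\<close> by (intro cong_1_power_mult) auto
  hence "[g ^ (p * d) = 1] (mod p ^ Suc j)"
    by (simp add: power_mult [symmetric] mult.commute)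
  hence "totient (p ^ Suc j) dvd p * d"
    using g by (simp only: ord_divides residue_primroot_def)
  \<comment> \<open>Here \<open>j > 0\<close> matters: for \<open>j = 0\<close> the two totients are
    \<open>p - 1\<close> and 1.\<close>
  moreover have "totient (p ^ Suc j) = p * totient (p ^ j)"
    using assms(1,2) by (cases j) (simp_all add: totient_prime_power del: power_Suc, simp)
  ultimately have "totient (p ^ j) dvd d"
    using p by simp
  moreover have "d dvd totient (p ^ j)"
    using g_coprime by (simp add: d_def order_divides_totient)
  ultimately show ?thesis
    using p g_coprime by (simp add: residue_primroot_def d_def dvd_antisym)
qed

lemma residue_primroot_prime_power_le:
  assumes "prime p" "i > 0" "i \<le> j" "residue_primroot (p ^ j) g"
  shows "residue_primroot (p ^ i) g"
  using assms(3,4)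
proof (induction j rule: dec_induct)
  case (step j)
  thus ?case
    using residue_primroot_prime_power_SucD[of p j g] assms(1,2) by simp
qed

lemma residue_primroot_odd_prime_power:
  assumes p: "prime p" "odd p" and "k \<ge> 2" "residue_primroot (p ^ k) g" "i > 0"
  shows "residue_primroot (p ^ i) g"
proof -
  have "residue_primroot (p ^ 1) g"
    using residue_primroot_prime_power_le[of p 1 k g] assms by simp
  moreover have p2: "residue_primroot (p ^ 2) g"
    using residue_primroot_prime_power_le[of p 2 k g] assms by simp
  have "[g ^ (p - 1) \<noteq> 1] (mod p\<^sup>2)"
  proof
    assume "[g ^ (p - 1) = 1] (mod p\<^sup>2)"
    \<comment> \<open>The left side is the totient of \<open>p\<^sup>2\<close>, which is the order
      of \<open>g\<close> modulo \<open>p\<^sup>2\<close>.\<close>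
    hence "p * (p - 1) dvd p - 1"
      using p2 p by (simp only: ord_divides residue_primroot_def totient_prime_power) simp
    thus False
      using prime_gt_1_nat[OF p(1)] by (auto dest!: dvd_imp_le)
  qed
  ultimately show ?thesis
    using residue_primroot_prime_lift_iff[OF p, of g] \<open>i > 0\<close> by simp
qed

lemma primitive_root_cong:
  assumes "[a = b] (mod int n)"
  shows "primitive_root n a \<longleftrightarrow> primitive_root n b"
proof -
  have "[a ^ m = 1] (mod int n) \<longleftrightarrow> [b ^ m = 1] (mod int n)" for m
    using cong_pow[OF assms, of m] by (simp add: cong_def)
  moreover have "coprime a (int n) \<longleftrightarrow> coprime b (int n)"
    using assms cong_imp_coprime cong_sym by blast
  ultimately show ?thesis
    by (simp add: primitive_root_def int_ord_def)
qed

lemma primitive_root_odd_prime_power: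
  assumes p: "prime p" "odd p" and "k \<ge> 2" "primitive_root (p ^ k) g" "i > 0"
  shows "primitive_root (p ^ i) g"
proof -
  \<comment> \<open>A single natural representative \<open>x\<close> of \<open>g\<close> must serve
    both moduli \<open>p ^ k\<close> and \<open>p ^ i\<close>, so it is taken modulo the larger
    one.\<close>
  define N where "N = p ^ max k i"
  define x where "x = nat (g mod int N)"
  have "N > 0"
    using p by (simp add: N_def prime_gt_0_nat)
  hence x: "[g = int x] (mod int N)"
    by (simp add: x_def cong_def)
  have "primitive_root (p ^ j) g \<longleftrightarrow> residue_primroot (p ^ j) x" if "j \<le> max k i" for j
  proof -
    have "int (p ^ j) dvd int N"
      unfolding N_def of_nat_dvd_iff using that by (rule le_imp_power_dvd)
    with x have "[g = int x] (mod int (p ^ j))"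
      by (rule cong_dvd_modulus)
    thus ?thesis
      by (simp only: primitive_root_cong primitive_root_of_nat)
  qed
  thus ?thesis
    using residue_primroot_odd_prime_power[of p k x i] assms by simp
qed

theorem theorem1:
  fixes p k :: nat
  assumes "prime p" and "odd p" and "k \<ge> 2"
  shows "(\<forall>g::int. primitive_root (p ^ k) g \<longrightarrow>
            (\<forall>t::int. 0 \<le> t \<and> t \<le> int p - 1 \<longrightarrow>
               primitive_root (p ^ (k + 1)) (g + t * int p ^ k))) \<and>
         (\<forall>r::int. primitive_root (p ^ (k + 1)) r \<and> 1 \<le> r \<and> r \<le> int p ^ (k + 1) \<longrightarrow>
            (\<exists>g t::int. primitive_root (p ^ k) g \<and> 1 \<le> g \<and> g \<le> int p ^ k \<and>
               0 \<le> t \<and> t \<le> int p - 1 \<and> r = g + t * int p ^ k))"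
proof (intro conjI allI impI; (elim conjE)?)
  fix g t :: int
  assume "primitive_root (p ^ k) g"
  moreover have "[g + t * int p ^ k = g] (mod int (p ^ k))"
    by (simp add: cong_def)
  ultimately have "primitive_root (p ^ k) (g + t * int p ^ k)"
    using primitive_root_cong by blast
  thus "primitive_root (p ^ (k + 1)) (g + t * int p ^ k)"
    by (rule primitive_root_odd_prime_power[OF assms]) simp
next
  fix r :: int
  assume r: "primitive_root (p ^ (k + 1)) r" "1 \<le> r" "r \<le> int p ^ (k + 1)"
  define q where "q = int p ^ k"
  have "q > 0"
    using assms(1) by (simp add: q_def prime_gt_0_nat)
  \<comment> \<open>Dividing \<open>r - 1\<close> instead of \<open>r\<close> puts the remainder
    part \<open>g\<close> in 1..q rather than 0..q-1.\<close>
  define g where "g = (r - 1) mod q + 1"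
  define t where "t = (r - 1) div q"
  have eq: "r = g + t * q"
    using div_mult_mod_eq[of "r - 1" q] by (simp add: g_def t_def)
  have g: "1 \<le> g" "g \<le> q"
    using \<open>q > 0\<close> pos_mod_bound[of q "r - 1"] unfolding g_def by (simp, linarith)
  have "0 \<le> t"
    using r(2) \<open>q > 0\<close> by (simp add: t_def pos_imp_zdiv_nonneg_iff)
  \<comment> \<open>Strict because \<open>t * q = r - g\<close> with \<open>g \<ge> 1\<close> and
    \<open>r \<le> p * q\<close>.\<close>
  have "t * q < int p * q"
    using r(3) g(1) eq by (simp add: q_def)
  hence "t \<le> int p - 1"
    using \<open>q > 0\<close> by simp
  \<comment> \<open>The passage between powers of \<open>p\<close> is used downwards here, from
    exponent \<open>k + 1\<close> to \<open>k\<close>.\<close>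
  have "primitive_root (p ^ k) r"
    using primitive_root_odd_prime_power[of p "k + 1" r k] r(1) assms by simp
  moreover have "[r = g] (mod int (p ^ k))"
    by (simp add: eq q_def cong_def)
  ultimately have "primitive_root (p ^ k) g"
    using primitive_root_cong by blast
  with g \<open>0 \<le> t\<close> \<open>t \<le> int p - 1\<close> eq
  show "\<exists>g t::int. primitive_root (p ^ k) g \<and> 1 \<le> g \<and> g \<le> int p ^ k \<and>
               0 \<le> t \<and> t \<le> int p - 1 \<and> r = g + t * int p ^ k"
    unfolding q_def by blast
qed

end
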